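(* Let $\widehat\sigma$ be a label-invariant estimator of the arrival times in the uniform random recursive tree $T_n$. Then, for any $n\ge 3$ and any $v\in[n]$, $$\mathbb{P}\Big(|\widehat\sigma(v)-v|\ge \frac{v}{56}\Big)\ \ge\ \frac{1}{224}.$$
   Context: $[n]=\{1,\dots,n\}$. The uniform random recursive tree $T_n$ on vertex set $[n]$ is sampled recursively: $T_1$ is the single vertex $1$ (the root); given $T_n$, choose $u\in\{1,\dots,n\}$ uniformly at random, independently of $T_1,\dots,T_n$, and add a new vertex $n+1$ together with the edge $\{u,n+1\}$. The label of a vertex is its arrival time. For a tree $t$ with vertex set $[n]$ and a permutation $\tau$ of $[n]$, $t^\tau$ is the labeled tree obtained by permuting the vertex labels by $\tau$. An (arrival-time) estimator assigns to each labeled tree $t$ on $[n]$ a (possibly random) bijection $\widehat\sigma(\cdot,t):[n]\to[n]$. It is label-invariant if, for every fixed labeled tree $t$, every permutation $\tau$ of its vertices and every vertex $u$, $\widehat\sigma(u,t)$ and $\widehat\sigma(\tau(u),t^\tau)$ have the same distribution. We write $\widehat\sigma(v)=\widehat\sigma(v,T_n)$, whose conditional law given $T_n=t$ is that of $\widehat\sigma(v,t)$. *)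

theory Defs
  imports "HOL-Probability.Probability" "HOL-Combinatorics.Permutations"
begin

text \<open>
  A labeled graph on $\{1,\dots,n\}$ is represented by its set of edges, each edge being a
  two-element set of labels; the vertex set is carried by the parameter \<open>n\<close>.
\<close>

type_synonym edges = "nat set set"

definition simple_graph_on :: "nat \<Rightarrow> edges \<Rightarrow> bool" where
  "simple_graph_on n t \<longleftrightarrow> (\<forall>e\<in>t. e \<subseteq> {1..n} \<and> card e = 2)"

definition connected_on :: "nat \<Rightarrow> edges \<Rightarrow> bool" where
  "connected_on n t \<longleftrightarrow> (\<forall>x\<in>{1..n}. \<forall>y\<in>{1..n}. (x, y) \<in> {(a, b). {a, b} \<in> t}\<^sup>*)"

text \<open>A cycle is listed by its vertices without repeating the first one at the end.\<close>

definition is_cycle :: "edges \<Rightarrow> nat list \<Rightarrow> bool" where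
  "is_cycle t p \<longleftrightarrow> 3 \<le> length p \<and> distinct p \<and>
     (\<forall>i<length p. {p ! i, p ! (Suc i mod length p)} \<in> t)"

definition labeled_tree :: "nat \<Rightarrow> edges \<Rightarrow> bool" where
  "labeled_tree n t \<longleftrightarrow> simple_graph_on n t \<and> connected_on n t \<and> (\<nexists>p. is_cycle t p)"

definition relabel :: "(nat \<Rightarrow> nat) \<Rightarrow> edges \<Rightarrow> edges" where
  "relabel \<tau> t = (\<lambda>e. \<tau> ` e) ` t"

text \<open>The law of the uniform random recursive tree $T_n$; the value at \<open>0\<close> is a dummy.\<close>

fun urrt :: "nat \<Rightarrow> edges pmf" where
  "urrt 0 = return_pmf {}"
| "urrt (Suc 0) = return_pmf {}"
| "urrt (Suc (Suc n)) =
     bind_pmf (urrt (Suc n)) (\<lambda>t.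
     bind_pmf (pmf_of_set {1..Suc n}) (\<lambda>u.
     return_pmf (insert {u, Suc (Suc n)} t)))"

text \<open>
  A randomized estimator is given by the law of the random bijection $\widehat\sigma(\cdot,t)$
  for each tree \<open>t\<close>. A bijection is a function on \<open>nat\<close> of which only the values on
  $\{1,\dots,n\}$ matter.
\<close>

type_synonym estimator = "edges \<Rightarrow> (nat \<Rightarrow> nat) pmf"

definition is_estimator :: "nat \<Rightarrow> estimator \<Rightarrow> bool" where
  "is_estimator n E \<longleftrightarrow>
     (\<forall>t. labeled_tree n t \<longrightarrow> (\<forall>\<sigma>\<in>set_pmf (E t). bij_betw \<sigma> {1..n} {1..n}))"

text \<open>Only the one-vertex marginals are required to agree, not the joint laws.\<close>

definition label_invariant :: "nat \<Rightarrow> estimator \<Rightarrow> bool" where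
  "label_invariant n E \<longleftrightarrow>
     (\<forall>t \<tau> u. labeled_tree n t \<longrightarrow> \<tau> permutes {1..n} \<longrightarrow> u \<in> {1..n} \<longrightarrow>
        map_pmf (\<lambda>\<sigma>. \<sigma> u) (E t) = map_pmf (\<lambda>\<sigma>. \<sigma> (\<tau> u)) (E (relabel \<tau> t)))"

text \<open>The law of $\widehat\sigma(v) = \widehat\sigma(v, T_n)$.\<close>

definition estimated_arrival :: "nat \<Rightarrow> estimator \<Rightarrow> nat \<Rightarrow> nat pmf" where
  "estimated_arrival n E v = bind_pmf (urrt n) (\<lambda>t. map_pmf (\<lambda>\<sigma>. \<sigma> v) (E t))"

end

theory Submission
  imports Defs
begin

text \<open>
  The idea is that a label-invariant estimator cannot tell a vertex \<open>v\<close> from an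
  earlier vertex \<open>w\<close> whenever exchanging the two labels turns the tree into another
  recursive tree, and that this happens so often that \<open>v\<close> is confused with many
  vertices, of which only a few can be placed near \<open>v\<close>.

  Since \<open>T\<^sub>n\<close> is uniform on recursive trees, a law-preserving exchange is any involution
  of a set of recursive trees. For \<open>2 \<le> w < v\<close>, exchanging the labels \<open>w\<close> and \<open>v\<close>
  keeps a tree recursive when the parent of \<open>v\<close> is older than \<open>w\<close> and \<open>w\<close> has no child
  strictly between \<open>w\<close> and \<open>v\<close>. The parents being independent, a telescoping product gives
  this event the probability \<open>(w - 1)\<^sup>2 / ((v - 1) (v - 2))\<close> (lemma \<open>card_swappable\<close>). On it, the
  estimates of \<open>w\<close> and of \<open>v\<close> fall into any given set \<open>S\<close> equally often.

  Let \<open>S\<close> be the set of positions at distance less than \<open>v / 56\<close> from \<open>v\<close>, and let \<open>p\<close> be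
  the probability that the estimate of \<open>v\<close> is in \<open>S\<close>. Then the estimate of \<open>w\<close> is in \<open>S\<close> with
  probability at least \<open>(w - 1)\<^sup>2 / ((v - 1) (v - 2)) - (1 - p)\<close>
  (lemma \<open>sum_hit_prob_swap_lower_bound\<close>). The estimator is a bijection, so the probabilities
  of hitting \<open>S\<close> add up to at most \<open>card S \<le> v / 28 + 1\<close> over all vertices. Summing the lower
  bounds over \<open>2 \<le> w < v\<close>, together with \<open>p\<close> for \<open>v\<close> itself, gives
  \<open>(2 v - 3) / 6 + p - (v - 2) (1 - p) \<le> v / 28 + 1\<close>, and this forces
  \<open>1 - p \<ge> 1 / 224\<close> as soon as \<open>v \<ge> 3\<close>.

  The vertices \<open>1\<close> and \<open>2\<close> are joined by an edge in every recursive tree and can always be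
  exchanged. For \<open>v \<le> 2\<close> the set \<open>S\<close> is just \<open>{v}\<close>, which is then hit by two vertices with the
  same probability \<open>p\<close>; hence \<open>p \<le> 1 / 2\<close>.
\<close>

section \<open>Recursive trees as uniform parent maps\<close>

text \<open>
  A recursive tree is determined by the parents of its non-root vertices, chosen freely among
  the older vertices. The value \<open>0\<close> marks the absence of a parent; as it is fixed by all
  permutations of the labels, conjugation with such a permutation respects it.
\<close>

definition parent_maps :: "nat \<Rightarrow> (nat \<Rightarrow> nat) set" where
  "parent_maps n = PiE_dflt {2..n} 0 (\<lambda>j. {1..<j})"

definition tree_of :: "nat \<Rightarrow> (nat \<Rightarrow> nat) \<Rightarrow> edges" where
  "tree_of n f = (\<lambda>j. {f j, j}) ` {2..n}"

lemma finite_parent_maps [simp]: "finite (parent_maps n)"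
  unfolding parent_maps_def by (intro finite_PiE_dflt) auto

lemma parent_maps_nonempty [simp]: "parent_maps n \<noteq> {}"
  unfolding parent_maps_def by auto

lemma parent_mapsD:
  assumes "f \<in> parent_maps n" "j \<in> {2..n}"
  shows "1 \<le> f j" "f j < j"
  using assms unfolding parent_maps_def PiE_dflt_def by auto

lemma parent_maps_outside:
  assumes "f \<in> parent_maps n" "j \<notin> {2..n}"
  shows "f j = 0"
  using assms unfolding parent_maps_def PiE_dflt_def by auto

lemma parent_mapsI:
  assumes "\<And>j. j \<in> {2..n} \<Longrightarrow> 1 \<le> f j \<and> f j < j" "\<And>j. j \<notin> {2..n} \<Longrightarrow> f j = 0"
  shows "f \<in> parent_maps n"
  using assms unfolding parent_maps_def PiE_dflt_def by auto

text \<open>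
  The step of the recursion chooses the parent of the new vertex independently of the parents
  chosen before, so the parent map is a product of uniform laws, which is uniform on the product.
\<close>

lemma urrt_eq_uniform_parent_map:
  "urrt (Suc n) = map_pmf (tree_of (Suc n)) (pmf_of_set (parent_maps (Suc n)))"
proof -
  have uniform: "pmf_of_set (parent_maps m) = Pi_pmf {2..m} 0 (\<lambda>j. pmf_of_set {1..<j})" for m
    unfolding parent_maps_def by (rule Pi_pmf_of_set[symmetric]) auto
  show ?thesis
  proof (induction n)
    case 0
    show ?case by (simp add: uniform tree_of_def)
  next
    case (Suc n)
    have ins: "{2..Suc (Suc n)} = insert (Suc (Suc n)) {2..Suc n}" by auto
    have tree: "tree_of (Suc (Suc n)) (f(Suc (Suc n) := u))
        = insert {u, Suc (Suc n)} (tree_of (Suc n) f)" for f u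
      unfolding tree_of_def ins by (auto simp: image_iff)
    have interval: "{Suc 0..<Suc (Suc n)} = {Suc 0..Suc n}" by auto
    have "map_pmf (tree_of (Suc (Suc n))) (pmf_of_set (parent_maps (Suc (Suc n))))
      = bind_pmf (pmf_of_set {1..Suc n}) (\<lambda>u. bind_pmf (pmf_of_set (parent_maps (Suc n)))
          (\<lambda>f. return_pmf (insert {u, Suc (Suc n)} (tree_of (Suc n) f))))"
      unfolding uniform ins
      by (subst Pi_pmf_insert') (auto simp: map_bind_pmf tree interval)
    also have "\<dots> = bind_pmf (pmf_of_set (parent_maps (Suc n)))
       (\<lambda>f. bind_pmf (pmf_of_set {1..Suc n}) 
          (\<lambda>u. return_pmf (insert {u, Suc (Suc n)} (tree_of (Suc n) f))))"
      by (rule bind_commute_pmf)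
    also have "\<dots> = urrt (Suc (Suc n))"
      by (simp only: urrt.simps Suc.IH bind_map_pmf)
    finally show ?case ..
  qed
qed

text \<open>
  Following parents leads from every vertex to the root. There is no cycle, since the two
  neighbours on it of its largest vertex would both have to be the parent of that vertex.
\<close>

lemma labeled_tree_tree_of:
  assumes f: "f \<in> parent_maps n"
  shows "labeled_tree n (tree_of n f)"
  unfolding labeled_tree_def
proof (intro conjI)
  let ?t = "tree_of n f"
  let ?R = "{(a, b). {a, b} \<in> ?t}"
  show "simple_graph_on n ?t"
    unfolding simple_graph_on_def tree_of_def
  proof
    fix e assume "e \<in> (\<lambda>j. {f j, j}) ` {2..n}"
    then obtain j where j: "j \<in> {2..n}" "e = {f j, j}" by auto
    with parent_mapsD[OF f j(1)] show "e \<subseteq> {1..n} \<and> card e = 2"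
      by (auto simp: card_insert_if)
  qed
  have "sym ?R" by (auto simp: sym_def insert_commute)
  have to_root: "(x, 1) \<in> ?R\<^sup>*" if "x \<in> {1..n}" for x
    using that
  proof (induction x rule: less_induct)
    case (less x)
    show ?case
    proof (cases "x = 1")
      case False
      with less.prems have x: "x \<in> {2..n}" by auto
      have "(x, f x) \<in> ?R" using x by (auto simp: tree_of_def insert_commute)
      moreover have "(f x, 1) \<in> ?R\<^sup>*"
        using less.IH[of "f x"] parent_mapsD[OF f x] x by auto
      ultimately show ?thesis by (rule converse_rtrancl_into_rtrancl)
    qed simp
  qed
  show "connected_on n ?t"
    unfolding connected_on_def
  proof (intro ballI)
    fix x y assume "x \<in> {1..n}" "y \<in> {1..n}"
    then show "(x, y) \<in> ?R\<^sup>*"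
      using to_root[of x] symD[OF sym_rtrancl[OF \<open>sym ?R\<close>] to_root[of y]]
      by (rule_tac rtrancl_trans) auto
  qed
  \<comment> \<open>For \<open>a = b\<close> the claim is vacuous, because no edge is a loop.\<close>
  have smaller_neighbour: "a = f b" if "{a, b} \<in> ?t" "a \<le> b" for a b
    using that parent_mapsD[OF f] by (fastforce simp: tree_of_def doubleton_eq_iff)
  show "\<nexists>p. is_cycle ?t p"
  proof
    assume "\<exists>p. is_cycle ?t p"
    then obtain p where len: "3 \<le> length p" and dist: "distinct p"
      and edge: "\<And>i. i < length p \<Longrightarrow> {p ! i, p ! (Suc i mod length p)} \<in> ?t"
      unfolding is_cycle_def by auto
    have "Max (set p) \<in> set p" using len by (intro Max_in) auto
    then obtain i where i: "i < length p" "p ! i = Max (set p)" by (auto simp: in_set_conv_nth)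
    \<comment> \<open>Positions of the successor and of the predecessor of the largest vertex.\<close>
    define s where "s = Suc i mod length p"
    define r where "r = (if i = 0 then length p - 1 else i - 1)"
    have s: "s < length p" unfolding s_def using len by (intro mod_less_divisor) auto
    have r: "r < length p" "Suc r mod length p = i" unfolding r_def using i len by auto
    have "s = (if Suc i = length p then 0 else Suc i)" unfolding s_def using i by auto
    then have "r \<noteq> s" using i len unfolding r_def by auto
    have "p ! s \<le> p ! i" "p ! r \<le> p ! i" using i s r by auto
    moreover have "{p ! s, p ! i} \<in> ?t" "{p ! r, p ! i} \<in> ?t"
      using edge[OF i(1)] edge[OF r(1)] r(2) by (auto simp: s_def insert_commute)
    ultimately have "p ! s = p ! r" using smaller_neighbour by metis
    then show False using dist s r \<open>r \<noteq> s\<close> by (simp add: nth_eq_iff_index_eq)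
  qed
qed

section \<open>Hitting probabilities of an estimator\<close>

definition hit_prob :: "nat \<Rightarrow> estimator \<Rightarrow> nat set \<Rightarrow> nat \<Rightarrow> (nat \<Rightarrow> nat) \<Rightarrow> real" where
  "hit_prob n E S w f = measure_pmf.prob (E (tree_of n f)) {\<sigma>. \<sigma> w \<in> S}"

lemma hit_prob_nonneg: "0 \<le> hit_prob n E S w f"
  and hit_prob_le_1: "hit_prob n E S w f \<le> 1"
  by (simp_all add: hit_prob_def)

text \<open>
  Probabilities over \<open>T\<^sub>n\<close> become finite sums over parent maps, in which exchanging labels is a
  mere reindexing.
\<close>

lemma prob_estimated_arrival:
  assumes "1 \<le> n"
  shows "measure_pmf.prob (estimated_arrival n E v) S
    = (\<Sum>f\<in>parent_maps n. hit_prob n E S v f) / card (parent_maps n)"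
proof -
  obtain m where m: "n = Suc m" using assms by (cases n) auto
  have "measure_pmf.prob (estimated_arrival n E v) S
      = pmf (map_pmf (\<lambda>k. k \<in> S) (estimated_arrival n E v)) True"
    by (simp add: pmf_map vimage_def)
  also have "map_pmf (\<lambda>k. k \<in> S) (estimated_arrival n E v)
     = bind_pmf (pmf_of_set (parent_maps n)) 
         (\<lambda>f. map_pmf (\<lambda>\<sigma>. \<sigma> v \<in> S) (E (tree_of n f)))"
    unfolding estimated_arrival_def m urrt_eq_uniform_parent_map
    by (simp add: map_bind_pmf bind_map_pmf pmf.map_comp o_def)
  also have "pmf \<dots> True = (\<Sum>f\<in>parent_maps n. hit_prob n E S v f) / card (parent_maps n)"
    by (subst pmf_bind_pmf_of_set) (auto simp: pmf_map vimage_def hit_prob_def)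
  finally show ?thesis .
qed

text \<open>
  Every outcome of the estimator is injective, so at most \<open>card S\<close> of the vertices
  are sent into \<open>S\<close>; taking expectations gives the bound on the sum of the probabilities.
\<close>

lemma sum_hit_prob_le_card:
  assumes est: "is_estimator n E" and f: "f \<in> parent_maps n"
    and W: "W \<subseteq> {1..n}" and S: "finite S"
  shows "(\<Sum>w\<in>W. hit_prob n E S w f) \<le> card S"
proof -
  let ?M = "E (tree_of n f)"
  have fin: "finite W" using W finite_subset by auto
  have integ: "integrable ?M (\<lambda>\<sigma>. indicat_real {\<sigma>. \<sigma> w \<in> S} \<sigma>)" for w
    by (rule measure_pmf.integrable_const_bound[where B = 1]) auto
  have "(\<Sum>w\<in>W. hit_prob n E S w f)
      = measure_pmf.expectation ?M (\<lambda>\<sigma>. \<Sum>w\<in>W. indicat_real {\<sigma>. \<sigma> w \<in> S} \<sigma>)"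
    by (subst Bochner_Integration.integral_sum) (simp_all add: hit_prob_def integ)
  also have "\<dots> \<le> measure_pmf.expectation ?M (\<lambda>\<sigma>. real (card S))"
  proof (rule integral_mono_AE)
    show "AE \<sigma> in ?M. (\<Sum>w\<in>W. indicat_real {\<sigma>. \<sigma> w \<in> S} \<sigma>) \<le> real (card S)"
    proof (rule AE_pmfI)
      fix \<sigma> assume "\<sigma> \<in> set_pmf ?M"
      then have "inj_on \<sigma> {1..n}"
        using est labeled_tree_tree_of[OF f] unfolding is_estimator_def bij_betw_def by blast
      then have "inj_on \<sigma> {w \<in> W. \<sigma> w \<in> S}" using W by (auto intro: inj_on_subset)
      then have "card {w \<in> W. \<sigma> w \<in> S} \<le> card S"
        by (rule card_inj_on_le) (auto simp: S)
      moreover have "(\<Sum>w\<in>W. indicat_real {\<sigma>. \<sigma> w \<in> S} \<sigma>) = card {w \<in> W. \<sigma> w \<in> S}"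
        using fin by (simp add: indicator_def sum.If_cases Int_def)
      ultimately show "(\<Sum>w\<in>W. indicat_real {\<sigma>. \<sigma> w \<in> S} \<sigma>) \<le> real (card S)" by simp
    qed
  qed (auto intro!: Bochner_Integration.integrable_sum integ)
  finally show ?thesis by simp
qed

lemma hit_prob_relabel:
  assumes inv: "label_invariant n E" and f: "f \<in> parent_maps n"
    and perm: "\<tau> permutes {1..n}" and v: "v \<in> {1..n}"
    and g: "tree_of n g = relabel \<tau> (tree_of n f)"
  shows "hit_prob n E S (\<tau> v) g = hit_prob n E S v f"
proof -
  have "map_pmf (\<lambda>\<sigma>. \<sigma> v) (E (tree_of n f)) = map_pmf (\<lambda>\<sigma>. \<sigma> (\<tau> v)) (E (tree_of n g))"
    using inv labeled_tree_tree_of[OF f] perm v unfolding label_invariant_def g by blast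
  then have "measure_pmf.prob (map_pmf (\<lambda>\<sigma>. \<sigma> v) (E (tree_of n f))) S
    = measure_pmf.prob (map_pmf (\<lambda>\<sigma>. \<sigma> (\<tau> v)) (E (tree_of n g))) S" by simp
  then show ?thesis by (simp add: hit_prob_def vimage_def)
qed

text \<open>
  Since \<open>T\<^sub>n\<close> is uniform, a tree and its image under an involution are equally likely. If the
  involution acts on the trees as a relabeling \<open>\<tau>\<close>, label-invariance makes \<open>v\<close> and \<open>\<tau> v\<close> indistinguishable on average over that set.
\<close>

lemma sum_hit_prob_transfer:
  assumes inv: "label_invariant n E" and A: "A \<subseteq> parent_maps n"
    and perm: "\<tau> permutes {1..n}" and v: "v \<in> {1..n}"
    and g: "\<And>f. f \<in> A \<Longrightarrow> g f \<in> A" "\<And>f. f \<in> A \<Longrightarrow> g (g f) = f"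
    and tree: "\<And>f. f \<in> A \<Longrightarrow> tree_of n (g f) = relabel \<tau> (tree_of n f)"
  shows "(\<Sum>f\<in>A. hit_prob n E S v f) = (\<Sum>f\<in>A. hit_prob n E S (\<tau> v) f)"
  by (rule sum.reindex_bij_witness[of _ g g])
    (use assms in \<open>auto intro!: hit_prob_relabel[OF inv _ perm v]\<close>)

section \<open>Exchanging two labels\<close>

text \<open>
  The two conditions say that, after the labels \<open>w\<close> and \<open>v\<close> are exchanged, the vertex now
  called \<open>w\<close> is younger than its parent and the vertex now called \<open>v\<close> is older than its
  children.
\<close>

definition swappable :: "nat \<Rightarrow> nat \<Rightarrow> nat \<Rightarrow> (nat \<Rightarrow> nat) set" where
  "swappable n w v = {f \<in> parent_maps n. f v < w \<and> (\<forall>j. w < j \<and> j < v \<longrightarrow> f j \<noteq> w)}"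

text \<open>
  Relabeling by \<open>\<tau>\<close> conjugates the parent map by \<open>\<tau>\<close>. Parents still precede their children:
  \<open>w\<close> and \<open>v\<close> merely trade their parents, both older than \<open>w\<close>, and a child of \<open>w\<close> receives the
  larger parent \<open>v\<close> only if it came after \<open>v\<close>.
\<close>

lemma swappable_involution:
  assumes f: "f \<in> swappable n w v" and wv: "2 \<le> w" "w < v" "v \<le> n"
  defines "\<tau> \<equiv> Transposition.transpose w v"
  shows "\<tau> \<circ> f \<circ> \<tau> \<in> swappable n w v"
    and "tree_of n (\<tau> \<circ> f \<circ> \<tau>) = relabel \<tau> (tree_of n f)"
proof -
  have fP: "f \<in> parent_maps n" and fv: "f v < w"
    and fj: "\<And>j. w < j \<Longrightarrow> j < v \<Longrightarrow> f j \<noteq> w"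
    using f by (auto simp: swappable_def)
  have bounds: "1 \<le> f j" "f j < j" if "2 \<le> j" "j \<le> n" for j
    using parent_mapsD[OF fP] that by auto
  have fw: "f w < w" using bounds[of w] wv by auto
  have at_w: "(\<tau> \<circ> f \<circ> \<tau>) w = f v" and at_v: "(\<tau> \<circ> f \<circ> \<tau>) v = f w"
    using fv fw wv by (auto simp: \<tau>_def Transposition.transpose_def)
  have at_other: "(\<tau> \<circ> f \<circ> \<tau>) j = \<tau> (f j)" if "j \<noteq> w" "j \<noteq> v" for j
    using that by (simp add: \<tau>_def)
  have "\<tau> \<circ> f \<circ> \<tau> \<in> parent_maps n"
  proof (rule parent_mapsI)
    fix j assume j: "j \<in> {2..n}"
    consider "j = w" | "j = v" | "j \<noteq> w" "j \<noteq> v" by blast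
    then show "1 \<le> (\<tau> \<circ> f \<circ> \<tau>) j \<and> (\<tau> \<circ> f \<circ> \<tau>) j < j"
    proof cases
      case 1 
      with at_w fv bounds[of v] wv show ?thesis by simp
    next
      case 2 
      with at_v fw bounds[of w] wv show ?thesis by simp
    next
      case 3
      have "v < j" if "f j = w"
        using fj[of j] bounds[of j] that j 3 by (cases j v rule: linorder_cases) auto
      then have "1 \<le> \<tau> (f j) \<and> \<tau> (f j) < j"
        using bounds[of j] j wv 3 by (auto simp: \<tau>_def Transposition.transpose_def)
      with at_other[OF 3] show ?thesis by simp
    qed
  next
    fix j assume j: "j \<notin> {2..n}"
    then have "\<tau> j = j" "f j = 0"
      using wv parent_maps_outside[OF fP] by (auto simp: \<tau>_def Transposition.transpose_def)
    then show "(\<tau> \<circ> f \<circ> \<tau>) j = 0" using wv by (simp add: \<tau>_def Transposition.transpose_def)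
  qed
  moreover have "(\<tau> \<circ> f \<circ> \<tau>) j \<noteq> w" if "w < j" "j < v" for j
    using that bounds[of j] wv at_other[of j] by (auto simp: \<tau>_def Transposition.transpose_def)
  ultimately show "\<tau> \<circ> f \<circ> \<tau> \<in> swappable n w v"
    using at_v fw by (auto simp: swappable_def)
  have "\<tau> permutes {2..n}" unfolding \<tau>_def using wv by (intro permutes_swap_id) auto
  then have "relabel \<tau> (tree_of n f) = (\<lambda>j. \<tau> ` {f j, j}) ` (\<tau> ` {2..n})"
    by (simp add: relabel_def tree_of_def image_image permutes_image)
  also have "\<dots> = tree_of n (\<tau> \<circ> f \<circ> \<tau>)"
    by (simp add: tree_of_def image_image \<tau>_def)
  finally show "tree_of n (\<tau> \<circ> f \<circ> \<tau>) = relabel \<tau> (tree_of n f)" ..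
qed

text \<open>
  The conditions defining \<open>swappable\<close> restrict each parent separately: \<open>w - 1\<close> choices remain
  for \<open>v\<close>, and \<open>j - 2\<close> instead of \<open>j - 1\<close> for every \<open>j\<close> strictly between \<open>w\<close> and \<open>v\<close>. The product
  of the factors \<open>(j - 2) / (j - 1)\<close> telescopes to \<open>(w - 1) / (v - 2)\<close>.
\<close>

lemma card_swappable:
  assumes wv: "2 \<le> w" "w < v" "v \<le> n"
  shows "card (swappable n w v) * ((v - 1) * (v - 2)) = (w - 1)\<^sup>2 * card (parent_maps n)"
proof -
  define B where "B j = (if j = v then {1..<w} else if w < j \<and> j < v then {1..<j} - {w} else {1..<j})"
    for j :: nat
  have eq: "swappable n w v = PiE_dflt {2..n} 0 B"
  proof (intro set_eqI iffI)
    fix f assume f: "f \<in> swappable n w v"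
    then have fP: "f \<in> parent_maps n" by (simp add: swappable_def)
    have "f j \<in> B j" if "j \<in> {2..n}" for j
      using f parent_mapsD[OF fP that] by (auto simp: swappable_def B_def)
    then show "f \<in> PiE_dflt {2..n} 0 B"
      using parent_maps_outside[OF fP] by (simp add: PiE_dflt_def)
  next
    fix f assume "f \<in> PiE_dflt {2..n} 0 B"
    then have inside: "\<And>j. j \<in> {2..n} \<Longrightarrow> f j \<in> B j"
      and outside: "\<And>j. j \<notin> {2..n} \<Longrightarrow> f j = 0"
      unfolding PiE_dflt_def by blast+
    have "B j \<subseteq> {1..<j}" for j using wv by (auto simp: B_def)
    then have "f \<in> parent_maps n"
      using inside outside unfolding parent_maps_def PiE_dflt_def by blast
    moreover have "f v < w" using inside[of v] wv by (simp add: B_def)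
    moreover have "f j \<noteq> w" if "w < j" "j < v" for j
      using inside[of j] wv that by (simp add: B_def)
    ultimately show "f \<in> swappable n w v" by (simp add: swappable_def)
  qed
  define R where "R = (\<Prod>j\<in>{2..n} - {w<..v}. j - 1)"
  have split: "{2..n} = insert v {w<..<v} \<union> ({2..n} - {w<..v})" using wv by auto
  have prod_split: "(\<Prod>j\<in>{2..n}. h j) = h v * (\<Prod>j\<in>{w<..<v}. h j) * (\<Prod>j\<in>{2..n} - {w<..v}. h j)"
    for h :: "nat \<Rightarrow> nat"
    using wv by (subst split, subst prod.union_disjoint) auto
  have "card (swappable n w v) = (\<Prod>j\<in>{2..n}. card (B j))"
    unfolding eq by (rule card_PiE_dflt) (auto simp: B_def)
  also have "\<dots> = (w - 1) * (\<Prod>j\<in>{w<..<v}. j - 2) * R"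
  proof -
    have "card (B v) = w - 1" by (simp add: B_def)
    moreover have "(\<Prod>j\<in>{w<..<v}. card (B j)) = (\<Prod>j\<in>{w<..<v}. j - 2)"
      using wv by (intro prod.cong) (auto simp: B_def)
    moreover have "(\<Prod>j\<in>{2..n} - {w<..v}. card (B j)) = R"
      unfolding R_def using wv by (intro prod.cong) (auto simp: B_def)
    ultimately show ?thesis by (simp only: prod_split)
  qed
  finally have cA: "card (swappable n w v) = (w - 1) * (\<Prod>j\<in>{w<..<v}. j - 2) * R" .
  have "card (parent_maps n) = (\<Prod>j\<in>{2..n}. j - 1)"
    unfolding parent_maps_def by (subst card_PiE_dflt) auto
  then have cF: "card (parent_maps n) = (v - 1) * (\<Prod>j\<in>{w<..<v}. j - 1) * R"
    unfolding R_def by (simp only: prod_split)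
  have "Suc w \<le> v" using wv by simp
  then have telescope: "(\<Prod>j\<in>{w<..<v}. j - 2) * (v - 2) = (w - 1) * (\<Prod>j\<in>{w<..<v}. j - 1)"
  proof (induction v rule: dec_induct)
    case base
    have "{w<..<Suc w} = {}" by auto
    then show ?case by simp
  next
    case (step m)
    have "{w<..<Suc m} = insert m {w<..<m}" using step.hyps by auto
    then show ?case
      using arg_cong[OF step.IH, of "\<lambda>x. x * (m - 1)"] by (simp add: mult_ac)
  qed
  show ?thesis unfolding cA cF power2_eq_square
    using arg_cong[OF telescope, of "\<lambda>x. (w - 1) * R * (v - 1) * x"]
    by (simp add: mult_ac)
qed

text \<open>
  Both vertices hit \<open>S\<close> equally often on the trees where they can be exchanged; on the
  remaining ones the loss is at most one per tree.
\<close>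

lemma sum_hit_prob_swap_lower_bound:
  assumes inv: "label_invariant n E" and wv: "2 \<le> w" "w < v" "v \<le> n"
  shows "(\<Sum>f\<in>parent_maps n. hit_prob n E S w f) \<ge>
    (\<Sum>f\<in>parent_maps n. hit_prob n E S v f)
     - real (card (parent_maps n)) * (1 - real ((w - 1)\<^sup>2) / ((real v - 1) * (real v - 2)))"
proof -
  let ?F = "parent_maps n" and ?A = "swappable n w v"
  have A: "?A \<subseteq> ?F" by (auto simp: swappable_def)
  have "(\<Sum>f\<in>?A. hit_prob n E S v f) = (\<Sum>f\<in>?A. hit_prob n E S (Transposition.transpose w v v) f)"
  proof (rule sum_hit_prob_transfer[OF inv A, where \<tau> = "Transposition.transpose w v"
        and g = "\<lambda>f. Transposition.transpose w v \<circ> f \<circ> Transposition.transpose w v"])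
    show "Transposition.transpose w v permutes {1..n}" using wv by (intro permutes_swap_id) auto
  qed (use wv swappable_involution[OF _ wv] in \<open>auto simp: fun_eq_iff\<close>)
  then have swap: "(\<Sum>f\<in>?A. hit_prob n E S v f) = (\<Sum>f\<in>?A. hit_prob n E S w f)" by simp
  have "(\<Sum>f\<in>?F. hit_prob n E S v f)
      = (\<Sum>f\<in>?F - ?A. hit_prob n E S v f) + (\<Sum>f\<in>?A. hit_prob n E S v f)"
    using A by (intro sum.subset_diff) auto
  also have "(\<Sum>f\<in>?F - ?A. hit_prob n E S v f) \<le> real (card (?F - ?A)) * 1"
    by (rule sum_bounded_above) (rule hit_prob_le_1)
  also have "real (card (?F - ?A)) = real (card ?F) - real (card ?A)"
    using A finite_subset[OF A] by (simp add: card_Diff_subset card_mono of_nat_diff)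
  also have "(\<Sum>f\<in>?A. hit_prob n E S v f) \<le> (\<Sum>f\<in>?F. hit_prob n E S w f)"
    unfolding swap using A by (intro sum_mono2) (auto simp: hit_prob_nonneg)
  finally have main: "(\<Sum>f\<in>?F. hit_prob n E S v f)
     \<le> (real (card ?F) - real (card ?A)) * 1 + (\<Sum>f\<in>?F. hit_prob n E S w f)" by simp
  have "real (card ?A) * ((real v - 1) * (real v - 2)) = real ((w - 1)\<^sup>2) * real (card ?F)"
    using arg_cong[OF card_swappable[OF wv], of real] wv
    by (simp add: of_nat_diff)
  then have "real (card ?A) = real (card ?F) * (real ((w - 1)\<^sup>2) / ((real v - 1) * (real v - 2)))"
    using wv by (simp only: times_divide_eq_right, subst nonzero_eq_divide_eq) (auto simp: mult.commute)
  with main show ?thesis by (simp add: algebra_simps)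
qed

text \<open>
  Exchanging the labels \<open>1\<close> and \<open>2\<close> reverses the edge between them, so the new parent
  map is not a conjugate of the old one: \<open>2\<close> keeps its parent \<open>1\<close>, while children of \<open>1\<close> and of \<open>2\<close>
  that came later change their parent.
\<close>

lemma sum_hit_prob_first_two:
  assumes inv: "label_invariant n E" and n: "2 \<le> n"
  shows "(\<Sum>f\<in>parent_maps n. hit_prob n E S 1 f) = (\<Sum>f\<in>parent_maps n. hit_prob n E S 2 f)"
proof -
  define \<tau> where "\<tau> = Transposition.transpose 1 (2::nat)"
  define g where "g f j = (if j = 2 then f j else \<tau> (f j))" for f :: "nat \<Rightarrow> nat" and j
  have f2: "f 2 = 1" if "f \<in> parent_maps n" for f
    using parent_mapsD[OF that, of 2] n by auto
  have "(\<Sum>f\<in>parent_maps n. hit_prob n E S 1 f) = (\<Sum>f\<in>parent_maps n. hit_prob n E S (\<tau> 1) f)"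
  proof (rule sum_hit_prob_transfer[OF inv, where g = g])
    show "\<tau> permutes {1..n}" unfolding \<tau>_def using n by (intro permutes_swap_id) auto
    fix f assume f: "f \<in> parent_maps n"
    show "g f \<in> parent_maps n"
    proof (rule parent_mapsI)
      fix j assume j: "j \<in> {2..n}"
      with parent_mapsD[OF f j] show "1 \<le> g f j \<and> g f j < j"
        by (auto simp: g_def \<tau>_def Transposition.transpose_def)
    next
      fix j assume "j \<notin> {2..n}"
      with parent_maps_outside[OF f this] n show "g f j = 0"
        by (auto simp: g_def \<tau>_def Transposition.transpose_def)
    qed
    show "g (g f) = f" by (auto simp: g_def \<tau>_def fun_eq_iff)
    have "{g f j, j} = \<tau> ` {f j, j}" if "j \<in> {2..n}" for j
      using that f2[OF f] by (auto simp: g_def \<tau>_def Transposition.transpose_def)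
    then show "tree_of n (g f) = relabel \<tau> (tree_of n f)"
      by (simp add: tree_of_def relabel_def image_image)
  qed (use n in auto)
  then show ?thesis by (simp add: \<tau>_def)
qed

section \<open>Numerical estimates\<close>

lemma sum_squares_before:
  assumes "3 \<le> v"
  shows "(\<Sum>w\<in>{2..<v}. real ((w - 1)\<^sup>2)) = (real v - 1) * (real v - 2) * (2 * real v - 3) / 6"
  using assms
proof (induction v rule: dec_induct)
  case base
  have "{2..<3::nat} = {2}" by auto
  then show ?case by simp
next
  case (step m)
  then have "{2..<Suc m} = insert m {2..<m}" by auto
  with step show ?case by (simp add: of_nat_diff field_simps power2_eq_square)
qed

lemma card_near_le:
  "finite {k. \<bar>real k - real v\<bar> < real v / 56}" (is "finite ?S")
  "real (card {k. \<bar>real k - real v\<bar> < real v / 56}) \<le> real v / 28 + 1"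
proof -
  define m where "m = v div 56"
  have sub: "?S \<subseteq> {v - m..v + m}"
  proof
    fix k assume "k \<in> ?S"
    then have "\<bar>real k - real v\<bar> < real v / 56" by simp
    then have "56 * real k < 57 * real v" "55 * real v < 56 * real k" by linarith+
    then have "real (56 * k) < real (57 * v)" "real (55 * v) < real (56 * k)" by simp_all
    then have "56 * k < 57 * v" "55 * v < 56 * k" by (simp_all only: of_nat_less_iff)
    then show "k \<in> {v - m..v + m}" unfolding m_def by auto
  qed
  then show "finite ?S" by (rule finite_subset) simp
  have "card ?S \<le> card {v - m..v + m}" by (rule card_mono[OF _ sub]) simp
  also have "\<dots> \<le> 2 * m + 1" by simp
  finally have "real (card ?S) \<le> 2 * real m + 1" by linarith
  also have "real m \<le> real v / 56"
  proof -
    have "56 * m \<le> v" by (simp add: m_def)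
    then have "real (56 * m) \<le> real v" by (simp only: of_nat_le_iff)
    then show ?thesis by simp
  qed
  finally show "real (card ?S) \<le> real v / 28 + 1" by simp
qed

section \<open>The lower bound on the error probability\<close>

theorem proposition1p2:
  fixes n v :: nat and E :: estimator
  assumes "is_estimator n E"
    and "label_invariant n E"
    and "n \<ge> 3"
    and "v \<in> {1..n}"
  shows "measure_pmf.prob (estimated_arrival n E v)
           {k. \<bar>real k - real v\<bar> \<ge> real v / 56} \<ge> 1 / 224"
proof -
  let ?F = "parent_maps n"
  define S where "S = {k. \<bar>real k - real v\<bar> < real v / 56}"
  define N where "N = real (card ?F)"
  define Q where "Q w = (\<Sum>f\<in>?F. hit_prob n E S w f)" for w
  define p where "p = measure_pmf.prob (estimated_arrival n E v) S"
  have N: "N > 0" by (simp add: N_def card_gt_0_iff)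
  have finS: "finite S" unfolding S_def by (rule card_near_le)
  have Qv: "Q v = p * N"
    using assms(3) N by (simp add: p_def Q_def N_def prob_estimated_arrival)
  \<comment> \<open>On every tree, the expected number of vertices that hit \<open>S\<close> is at most \<open>card S\<close>.\<close>
  have budget: "(\<Sum>w\<in>W. Q w) \<le> N * card S" if "W \<subseteq> {1..n}" for W
  proof -
    have "(\<Sum>w\<in>W. Q w) = (\<Sum>f\<in>?F. \<Sum>w\<in>W. hit_prob n E S w f)"
      unfolding Q_def by (rule sum.swap)
    also have "\<dots> \<le> real (card ?F) * real (card S)"
      by (rule sum_bounded_above) (rule sum_hit_prob_le_card[OF assms(1) _ that finS])
    finally show ?thesis by (simp add: N_def)
  qed
  have "p \<le> 223 / 224"
  proof (cases "v \<le> 2")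
    case True
    then have "v = 1 \<or> v = 2" using assms(4) by auto
    \<comment> \<open>Being an integer below \<open>2 / 28 + 1 < 2\<close>, the cardinality is at most \<open>1\<close>.\<close>
    have S: "real (card S) \<le> 1"
    proof -
      have "real (card S) < 2" using card_near_le(2)[of v] True unfolding S_def by linarith
      then show ?thesis by simp
    qed
    have "Q 1 = Q 2" 
      unfolding Q_def using assms(2,3) by (intro sum_hit_prob_first_two) auto
    moreover have "(\<Sum>w\<in>{1, 2}. Q w) \<le> N * card S" using assms(3) by (intro budget) auto
    moreover have "N * card S \<le> N * 1" using S N by (intro mult_left_mono) auto
    ultimately have "2 * Q v \<le> N" using \<open>v = 1 \<or> v = 2\<close> by auto
    then have "N * (2 * p) \<le> N * 1" using Qv by (simp add: algebra_simps)
    then have "2 * p \<le> 1" using N by (simp only: mult_le_cancel_left_pos)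
    then show ?thesis by simp
  next
    case False
    then have v: "3 \<le> v" "v \<le> n" using assms(4) by auto
    define c where "c w = real ((w - 1)\<^sup>2) / ((real v - 1) * (real v - 2))" for w
    have "(\<Sum>w\<in>{2..<v}. c w) = (\<Sum>w\<in>{2..<v}. real ((w - 1)\<^sup>2)) / ((real v - 1) * (real v - 2))"
      unfolding c_def by (rule sum_divide_distrib[symmetric])
    also have "\<dots> = (2 * real v - 3) / 6"
      unfolding sum_squares_before[OF v(1)] using v(1) by simp
    finally have sum_c: "(\<Sum>w\<in>{2..<v}. c w) = (2 * real v - 3) / 6" .
    have lower: "Q w \<ge> N * (p - 1 + c w)" if "w \<in> {2..<v}" for w
      using sum_hit_prob_swap_lower_bound[OF assms(2), of w v S] that v Qv
      unfolding Q_def[symmetric] N_def[symmetric] c_def[symmetric] by (simp add: algebra_simps)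
    have "N * ((real v - 2) * (p - 1) + (2 * real v - 3) / 6 + p)
       = (\<Sum>w\<in>{2..<v}. N * (p - 1 + c w)) + Q v"
      unfolding sum_distrib_left[symmetric] sum.distrib sum_c Qv
      using v(1) by (simp add: of_nat_diff algebra_simps)
    also have "\<dots> \<le> (\<Sum>w\<in>{2..<v}. Q w) + Q v"
      using lower by (intro add_right_mono sum_mono)
    also have "\<dots> = (\<Sum>w\<in>{2..v}. Q w)"
    proof -
      have "{2..v} = insert v {2..<v}" using v by auto
      then show ?thesis by simp
    qed
    also have "\<dots> \<le> N * card S" using v by (intro budget) auto
    also have "\<dots> \<le> N * (real v / 28 + 1)"
      unfolding S_def using N card_near_le(2)[of v] by (intro mult_left_mono) auto
    finally have "(real v - 2) * (p - 1) + (2 * real v - 3) / 6 + p \<le> real v / 28 + 1"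
      using N by (simp only: mult_le_cancel_left_pos)
    then have "(real v - 1) * (1 - p) \<ge> (2 * real v - 3) / 6 - real v / 28"
      by (simp add: algebra_simps)
    moreover have "(2 * real v - 3) / 6 - real v / 28 \<ge> (real v - 1) * (1 / 224)"
      using v(1) by (simp add: field_simps)
    ultimately have "(real v - 1) * (1 / 224) \<le> (real v - 1) * (1 - p)" by linarith
    then have "1 / 224 \<le> 1 - p"
      using v(1) by (subst (asm) mult_le_cancel_left_pos) auto
    then show ?thesis by simp
  qed
  moreover have "measure_pmf.prob (estimated_arrival n E v) (UNIV - S) = 1 - p"
    unfolding p_def using measure_pmf.prob_compl[of S "estimated_arrival n E v"] by simp
  moreover have "{k. \<bar>real k - real v\<bar> \<ge> real v / 56} = UNIV - S" by (auto simp: S_def)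
  ultimately show ?thesis by simp
qed

end
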